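(* Let $X$ be a random context in $\mathcal{X}$, let $w^\star:\mathcal{X}\to\mathbb{R}^J$ be the target weight map, and let $C:\mathcal{X}\to\{1,\dots,K\}$ be a fixed measurable partition of the context space. Let $$\mathcal{W}_C=\left\{w:\mathcal{X}\to\mathbb{R}^J \;:\; w(x)=\beta_{C(x)}\text{ for some }\beta_1,\dots,\beta_K\in\mathbb{R}^J\right\},$$ and let $w_C^\dagger(x):=\mathbb{E}[w^\star(X)\mid C(X)=C(x)]$ be the conditional-mean projection of $w^\star$ onto this class. Then for any hard estimator $\hat w_C\in\mathcal{W}_C$, $$\mathbb{E}\left[\|w^\star(X)-\hat w_C(X)\|_2^2\right]=\underbrace{\mathbb{E}\left[\|w^\star(X)-w_C^\dagger(X)\|_2^2\right]}_{\mathcal{H}(C)}+\underbrace{\mathbb{E}\left[\|w_C^\dagger(X)-\hat w_C(X)\|_2^2\right]}_{\mathcal{E}_{\mathrm{hard}}(C)}.$$ Equivalently, $$\mathcal{H}(C)=\mathbb{E}\left[\mathrm{tr}\,\mathrm{Var}\left(w^\star(X)\mid C(X)\right)\right].$$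
   Context: $\mathrm{Var}(w^\star(X)\mid C(X))$ denotes the conditional $J\times J$ covariance matrix of $w^\star(X)$ given $C(X)$, and $\mathrm{tr}$ is the trace. A hard estimator is one whose output is an element $\hat w_C$ of $\mathcal{W}_C$, i.e. its coefficient vector is constant on each cell of the partition. $\mathcal{H}(C)$ and $\mathcal{E}_{\mathrm{hard}}(C)$ are names for the two underbraced terms (approximation and estimation). *)

theory Defs
  imports "HOL-Probability.Probability"
begin

text \<open>
  Here \<open>M\<close> is the underlying probability space, \<open>N\<close> the measurable space of contexts,
  \<open>X\<close> the random context (a map from \<open>M\<close> to \<open>N\<close>), and \<open>C\<close> assigns to each context
  the index of its cell. The norm on \<open>real ^ 'j\<close> is the Euclidean one.
\<close>

definition hard_class :: "'x measure \<Rightarrow> ('x \<Rightarrow> nat) \<Rightarrow> ('x \<Rightarrow> real ^ 'j) set" where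
  "hard_class N C = {w. \<exists>\<beta>. \<forall>x\<in>space N. w x = \<beta> (C x)}"

text \<open>
  The function \<open>x \<mapsto> E[w(X) | C(X) = C(x)]\<close>. The conditioning event has an elementary
  conditional law, given by \<^const>\<open>uniform_measure\<close>. On cells of probability zero,
  where the conditional mean is not determined, the value is \<open>0\<close>.
\<close>

definition cond_mean_proj ::
    "'m measure \<Rightarrow> ('m \<Rightarrow> 'x) \<Rightarrow> ('x \<Rightarrow> nat) \<Rightarrow> ('x \<Rightarrow> real ^ 'j) \<Rightarrow> 'x \<Rightarrow> real ^ 'j" where
  "cond_mean_proj M X C w x =
    (\<integral>\<omega>. w (X \<omega>) \<partial>uniform_measure M {\<omega> \<in> space M. C (X \<omega>) = C x})"

definition cond_cov :: "'m measure \<Rightarrow> 'm measure \<Rightarrow> ('m \<Rightarrow> real ^ 'j) \<Rightarrow> 'm \<Rightarrow> real ^ 'j ^ 'j" where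
  "cond_cov M F Y \<omega> = (\<chi> i j. real_cond_exp M F
     (\<lambda>\<xi>. (Y \<xi> $ i - real_cond_exp M F (\<lambda>\<zeta>. Y \<zeta> $ i) \<xi>) *
          (Y \<xi> $ j - real_cond_exp M F (\<lambda>\<zeta>. Y \<zeta> $ j) \<xi>)) \<omega>)"

text \<open>
  Mean squared errors are expectations of nonnegative variables, valued in \<open>[0, \<infinity>]\<close>.
\<close>

definition mse :: "'m measure \<Rightarrow> ('m \<Rightarrow> real ^ 'j) \<Rightarrow> ('m \<Rightarrow> real ^ 'j) \<Rightarrow> ennreal" where
  "mse M U V = (\<integral>\<^sup>+\<omega>. ennreal ((norm (U \<omega> - V \<omega>))\<^sup>2) \<partial>M)"

definition approx_error ::
    "'m measure \<Rightarrow> ('m \<Rightarrow> 'x) \<Rightarrow> ('x \<Rightarrow> nat) \<Rightarrow> ('x \<Rightarrow> real ^ 'j) \<Rightarrow> ennreal" where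
  "approx_error M X C w = mse M (\<lambda>\<omega>. w (X \<omega>)) (\<lambda>\<omega>. cond_mean_proj M X C w (X \<omega>))"

text \<open>
  The estimator \<open>A\<close> turns the training data \<open>D\<close>, with values in \<open>S\<close>, into a member of
  the hard class; the data are independent of the context \<open>X\<close> at which it is evaluated.
  Independence is stated for the generated sigma-algebras because
  \<open>indep_var\<close> requires both variables to have the same type.
\<close>

definition hard_estimator ::
    "'m measure \<Rightarrow> 'x measure \<Rightarrow> ('m \<Rightarrow> 'x) \<Rightarrow> ('x \<Rightarrow> nat) \<Rightarrow>
     'd measure \<Rightarrow> ('m \<Rightarrow> 'd) \<Rightarrow> ('d \<Rightarrow> 'x \<Rightarrow> real ^ 'j) \<Rightarrow> bool" where
  "hard_estimator M N X C S D A \<longleftrightarrow>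
     D \<in> measurable M S \<and>
     prob_space.indep_set M (sets (vimage_algebra (space M) X N))
                            (sets (vimage_algebra (space M) D S)) \<and>
     (\<forall>d\<in>space S. A d \<in> hard_class N C) \<and>
     (\<forall>x\<in>space N. (\<lambda>d. A d x) \<in> borel_measurable S)"

end

theory Submission
  imports Defs
begin

text \<open>
  On each cell the residual of \<open>w\<close> from its cell mean integrates to zero, so it is orthogonal to
  every function that is constant on cells. There are finitely many cells, hence
  such functions are bounded and Pythagoras applies without assuming that \<open>w\<close> is square integrable:
  if the approximation error is infinite, then both sides are. For an estimator trained on
  independent data, Tonelli reduces the identity to the one for a fixed value of the data.
\<close>

section \<open>Cell means and integrals over a single cell\<close>

definition cell_mean :: "'m measure \<Rightarrow> ('m \<Rightarrow> 'k) \<Rightarrow> ('m \<Rightarrow> 'a) \<Rightarrow> 'k \<Rightarrow> 'a::euclidean_space" where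
  "cell_mean M Z Y k = (\<integral>\<omega>. Y \<omega> \<partial>uniform_measure M {\<omega> \<in> space M. Z \<omega> = k})"

lemma integral_uniform_measure:
  fixes f :: "'m \<Rightarrow> 'a::euclidean_space"
  assumes [measurable]: "f \<in> borel_measurable M" "A \<in> sets M" and fin: "emeasure M A \<noteq> \<infinity>"
  shows "(\<integral>\<omega>. f \<omega> \<partial>uniform_measure M A) = (\<integral>\<omega>. indicator A \<omega> *\<^sub>R f \<omega> \<partial>M) /\<^sub>R measure M A"
proof (cases "emeasure M A = 0")
  \<comment> \<open>For a null set \<open>A\<close> the density defining
    \<open>uniform_measure\<close> is infinite on \<open>A\<close> and zero elsewhere, so the
    measure vanishes. The right side is also zero, because \<open>inverse 0 = 0\<close> in the
    reals.\<close>
  case True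
  then have "AE \<omega> in M. \<omega> \<notin> A"
    by (simp add: AE_not_in null_setsI)
  then have "AE \<omega> in uniform_measure M A. f \<omega> = 0"
    by (intro AE_uniform_measureI) auto
  then have "(\<integral>\<omega>. f \<omega> \<partial>uniform_measure M A) = 0"
    by (rule integral_eq_zero_AE)
  with True show ?thesis by (simp add: measure_def)
next
  case False
  \<comment> \<open>As \<open>A\<close> has positive finite measure, the density of
    \<open>uniform_measure\<close> can be written with a real quotient, which is the form that
    \<open>integral_density\<close> handles.\<close>
  have "emeasure M A = ennreal (measure M A)"
    using fin by (simp add: emeasure_eq_ennreal_measure)
  moreover from this False have "0 < measure M A"
    by (metis ennreal_0 measure_nonneg order_le_less)
  ultimately have "uniform_measure M A = density M (\<lambda>\<omega>. ennreal (indicator A \<omega> / measure M A))"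
    unfolding uniform_measure_def
    by (intro arg_cong[where f = "density M"] ext) (auto simp: divide_ennreal[symmetric] split: split_indicator)
  moreover have "(\<integral>\<omega>. f \<omega> \<partial>density M (\<lambda>\<omega>. ennreal (indicator A \<omega> / measure M A))) =
      (\<integral>\<omega>. (indicator A \<omega> *\<^sub>R f \<omega>) /\<^sub>R measure M A \<partial>M)"
    by (subst integral_density) (auto simp: divide_inverse mult.commute)
  ultimately show ?thesis
    by (simp del: scaleR_scaleR)
qed

context prob_space
begin

text \<open>Multiplying by the probability of the cell instead of dividing by it makes the identity
  cover null cells too: there both sides vanish, whatever value the cell mean takes.\<close>

lemma integral_indicator_cell_mean:
  fixes Y :: "'a \<Rightarrow> 'b::euclidean_space"
  assumes Y [measurable]: "Y \<in> borel_measurable M" and A [measurable]: "{\<omega> \<in> space M. Z \<omega> = k} \<in> sets M"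
  shows "prob {\<omega> \<in> space M. Z \<omega> = k} *\<^sub>R cell_mean M Z Y k =
    (\<integral>\<omega>. indicator {\<omega> \<in> space M. Z \<omega> = k} \<omega> *\<^sub>R Y \<omega> \<partial>M)" (is "prob ?A *\<^sub>R _ = _")
proof (cases "prob ?A = 0")
  case True
  then have "?A \<in> null_sets M"
    by (intro null_setsI) (simp_all add: emeasure_eq_measure)
  then have "AE \<omega> in M. \<omega> \<notin> ?A"
    by (rule AE_not_in)
  then have "(\<integral>\<omega>. indicator ?A \<omega> *\<^sub>R Y \<omega> \<partial>M) = 0"
    by (intro integral_eq_zero_AE) auto
  with True show ?thesis by simp
next
  case False
  then show ?thesis
    by (simp add: cell_mean_def integral_uniform_measure)
qed

section \<open>Orthogonality of the residual and the Pythagorean identity\<close>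

lemma integrable_discrete:
  fixes u :: "'k \<Rightarrow> 'b::euclidean_space"
  assumes I: "finite I" and Z: "Z \<in> measurable M (count_space I)"
  shows "integrable M (\<lambda>\<omega>. u (Z \<omega>))"
proof (rule integrable_const_bound)
  show "AE \<omega> in M. norm (u (Z \<omega>)) \<le> (\<Sum>k\<in>I. norm (u k))"
    using measurable_space[OF Z] I by (intro AE_I2 member_le_sum) auto
  show "(\<lambda>\<omega>. u (Z \<omega>)) \<in> borel_measurable M"
    using Z by (rule measurable_compose) simp
qed

text \<open>A function of \<open>Z\<close> is a finite combination of cell indicators, and the
  residual has integral zero over each cell. Since \<open>u\<close> is constant on a cell, the inner
  product is there a fixed linear functional of the integrable residual, so integrability of
  \<open>Y\<close> is enough for the product.\<close>

lemma inner_cell_mean_orthogonal: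
  fixes Y :: "'a \<Rightarrow> 'b::euclidean_space"
  assumes I: "finite I" and Z: "Z \<in> measurable M (count_space I)" and Y: "integrable M Y"
  shows "integrable M (\<lambda>\<omega>. (Y \<omega> - cell_mean M Z Y (Z \<omega>)) \<bullet> u (Z \<omega>))"
    and "(\<integral>\<omega>. (Y \<omega> - cell_mean M Z Y (Z \<omega>)) \<bullet> u (Z \<omega>) \<partial>M) = 0"
proof -
  let ?A = "\<lambda>k. {\<omega> \<in> space M. Z \<omega> = k}"
  \<comment> \<open>\<open>R k\<close> is the residual cut off to cell \<open>k\<close>. Writing it
    as a difference of two cut-off functions lets each be integrated on its own.\<close>
  define R where "R k \<omega> = indicator (?A k) \<omega> *\<^sub>R Y \<omega> - indicator (?A k) \<omega> *\<^sub>R cell_mean M Z Y k" for k \<omega>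
  have A [measurable]: "?A k \<in> sets M" if "k \<in> I" for k
    using measurable_sets[OF Z, of "{k}"] that by (simp add: vimage_def Int_def conj_commute)
  have split: "(Y \<omega> - cell_mean M Z Y (Z \<omega>)) \<bullet> u (Z \<omega>) = (\<Sum>k\<in>I. R k \<omega> \<bullet> u k)"
    if "\<omega> \<in> space M" for \<omega>
  proof -
    have "(\<Sum>k\<in>I. R k \<omega> \<bullet> u k) =
        (\<Sum>k\<in>I. if k = Z \<omega> then (Y \<omega> - cell_mean M Z Y k) \<bullet> u k else 0)"
      using that by (intro sum.cong) (auto simp: R_def)
    also have "\<dots> = (Y \<omega> - cell_mean M Z Y (Z \<omega>)) \<bullet> u (Z \<omega>)"
      using I measurable_space[OF Z that] by simp
    finally show ?thesis ..
  qed
  have R: "integrable M (R k)" "(\<integral>\<omega>. R k \<omega> \<partial>M) = 0" if "k \<in> I" for k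
  proof -
    have 1: "integrable M (\<lambda>\<omega>. indicator (?A k) \<omega> *\<^sub>R Y \<omega>)"
      using A[OF that] Y by (rule integrable_mult_indicator)
    have 2: "integrable M (\<lambda>\<omega>. indicator (?A k) \<omega> *\<^sub>R cell_mean M Z Y k)"
      using A[OF that] by (rule integrable_mult_indicator) simp
    show "integrable M (R k)"
      unfolding R_def using 1 2 by (rule Bochner_Integration.integrable_diff)
    have "(\<integral>\<omega>. indicator (?A k) \<omega> *\<^sub>R cell_mean M Z Y k \<partial>M) = prob (?A k) *\<^sub>R cell_mean M Z Y k"
      using A[OF that] by (subst integral_scaleR_left) (auto simp: less_top[symmetric])
    then show "(\<integral>\<omega>. R k \<omega> \<partial>M) = 0"
      unfolding R_def using integral_indicator_cell_mean[OF borel_measurable_integrable[OF Y] A[OF that]] 1 2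
      by simp
  qed
  show "integrable M (\<lambda>\<omega>. (Y \<omega> - cell_mean M Z Y (Z \<omega>)) \<bullet> u (Z \<omega>))"
    by (subst Bochner_Integration.integrable_cong[OF refl split]) (auto intro!: R)
  show "(\<integral>\<omega>. (Y \<omega> - cell_mean M Z Y (Z \<omega>)) \<bullet> u (Z \<omega>) \<partial>M) = 0"
    by (subst Bochner_Integration.integral_cong[OF refl split]) (auto simp: R)
qed

lemma mse_cell_mean_decomposition:
  fixes Y :: "'a \<Rightarrow> real ^ 'j"
  assumes I: "finite I" and Z: "Z \<in> measurable M (count_space I)" and Y: "integrable M Y"
  shows "mse M Y (\<lambda>\<omega>. u (Z \<omega>)) =
    mse M Y (\<lambda>\<omega>. cell_mean M Z Y (Z \<omega>)) + mse M (\<lambda>\<omega>. cell_mean M Z Y (Z \<omega>)) (\<lambda>\<omega>. u (Z \<omega>))"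
proof -
  let ?m = "cell_mean M Z Y"
  note [measurable] = borel_measurable_integrable[OF Y]
  have mz [measurable]: "(\<lambda>\<omega>. g (Z \<omega>)) \<in> borel_measurable M" for g :: "_ \<Rightarrow> real ^ 'j"
    using Z by (rule measurable_compose) simp
  let ?a = "\<lambda>\<omega>. (norm (Y \<omega> - ?m (Z \<omega>)))\<^sup>2"
  let ?b = "\<lambda>\<omega>. (norm (?m (Z \<omega>) - u (Z \<omega>)))\<^sup>2"
  let ?c = "\<lambda>\<omega>. (norm (Y \<omega> - u (Z \<omega>)))\<^sup>2"
  let ?x = "\<lambda>\<omega>. (Y \<omega> - ?m (Z \<omega>)) \<bullet> (?m (Z \<omega>) - u (Z \<omega>))"
  have b: "integrable M ?b"
    using integrable_discrete[OF I Z, of "\<lambda>k. (norm (?m k - u k))\<^sup>2"] .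
  have x: "integrable M ?x" "integral\<^sup>L M ?x = 0"
    using inner_cell_mean_orthogonal[OF I Z Y, of "\<lambda>k. ?m k - u k"] by auto
  \<comment> \<open>Polarization: the two arguments sum to
    \<open>Y \<omega> - u (Z \<omega>)\<close>, the cell mean cancelling.\<close>
  have c_eq: "?c \<omega> = ?a \<omega> + ?b \<omega> + 2 * ?x \<omega>" for \<omega>
    using dot_norm[of "Y \<omega> - ?m (Z \<omega>)" "?m (Z \<omega>) - u (Z \<omega>)"] by simp
  show ?thesis
  proof (cases "integrable M ?a")
    case True
    have "integrable M ?c"
      unfolding c_eq using True b x by simp
    then have "mse M Y (\<lambda>\<omega>. u (Z \<omega>)) = ennreal (integral\<^sup>L M ?c)"
      unfolding mse_def by (intro nn_integral_eq_integral) simp_all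
    also have "integral\<^sup>L M ?c = integral\<^sup>L M ?a + integral\<^sup>L M ?b"
      unfolding c_eq using True b x by simp
    also have "ennreal \<dots> = ennreal (integral\<^sup>L M ?a) + ennreal (integral\<^sup>L M ?b)"
      by simp
    finally show ?thesis
      unfolding mse_def using True b by (simp add: nn_integral_eq_integral)
  next
    case False
    \<comment> \<open>\<open>?b\<close> and \<open>?x\<close> are integrable in every case, so by
      \<open>c_eq\<close> the integrability of \<open>?c\<close> would force that of
      \<open>?a\<close>.\<close>
    have "\<not> integrable M ?c"
    proof
      assume "integrable M ?c"
      then have "integrable M (\<lambda>\<omega>. ?c \<omega> - ?b \<omega> - 2 * ?x \<omega>)"
        using b x by simp
      then show False using False by (simp add: c_eq)
    qed
    \<comment> \<open>A nonnegative measurable function that is not integrable has infinite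
      integral, so the identity reads infinity on both sides.\<close>
    with False have "mse M Y (\<lambda>\<omega>. u (Z \<omega>)) = \<infinity>" "mse M Y (\<lambda>\<omega>. ?m (Z \<omega>)) = \<infinity>"
      unfolding mse_def by (simp_all add: integrable_iff_bounded less_top[symmetric])
    then show ?thesis by simp
  qed
qed

section \<open>Conditional expectation and covariance given the cell\<close>

lemma real_cond_exp_eq_cell_mean:
  fixes Y :: "'a \<Rightarrow> real ^ 'j"
  assumes I: "finite I" and Z: "Z \<in> measurable M (count_space I)" and Y: "integrable M Y"
  shows "AE \<omega> in M. real_cond_exp M (vimage_algebra (space M) Z (count_space I)) (\<lambda>\<xi>. Y \<xi> $ i) \<omega> =
    cell_mean M Z Y (Z \<omega>) $ i"
proof -
  let ?F = "vimage_algebra (space M) Z (count_space I)"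
  interpret finite_measure_subalgebra M ?F
    by unfold_locales (use measurable_sets[OF Z] measurable_space[OF Z] in
      \<open>auto simp: subalgebra_def sets_vimage_algebra2\<close>)
  have Yi: "integrable M (\<lambda>\<omega>. Y \<omega> $ i)"
    using bounded_linear_vec_nth Y by (rule integrable_bounded_linear)
  have mi: "integrable M (\<lambda>\<omega>. cell_mean M Z Y (Z \<omega>) $ i)"
    using integrable_discrete[OF I Z, of "\<lambda>k. cell_mean M Z Y k $ i"] .
  show ?thesis
  \<comment> \<open>The conditional expectation is characterized by its integrals over the sets of
    \<open>?F\<close>, which are the preimages of sets \<open>B\<close> of labels.\<close>
  proof (rule real_cond_exp_charact[OF _ Yi mi])
    show "(\<lambda>\<omega>. cell_mean M Z Y (Z \<omega>) $ i) \<in> borel_measurable ?F"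
      by (rule measurable_compose[OF measurable_vimage_algebra1, of _ _ "count_space I"])
        (use measurable_space[OF Z] in auto)
    fix A assume "A \<in> sets ?F"
    then obtain B where A: "A = Z -` B \<inter> space M"
      using measurable_space[OF Z] by (auto simp: sets_vimage_algebra2)
    have AM: "A \<in> sets M"
      using \<open>A \<in> sets ?F\<close> subalg by (auto simp: subalgebra_def)
    have "(\<integral>\<omega>\<in>A. Y \<omega> $ i \<partial>M) - (\<integral>\<omega>\<in>A. cell_mean M Z Y (Z \<omega>) $ i \<partial>M) =
        (\<integral>\<omega>\<in>A. Y \<omega> $ i - cell_mean M Z Y (Z \<omega>) $ i \<partial>M)"
      using AM Yi mi by (intro set_integral_diff(2)[symmetric])
        (auto simp: set_integrable_def intro!: integrable_mult_indicator[where 'b=real, simplified])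
    \<comment> \<open>The test function is the indicator of \<open>B\<close> times the
      \<open>i\<close>-th unit vector: it is constant on cells and extracts both the set
      \<open>A\<close> and the component \<open>i\<close>, so orthogonality finishes the
      proof.\<close>
    also have "\<dots> = (\<integral>\<omega>. (Y \<omega> - cell_mean M Z Y (Z \<omega>)) \<bullet> (indicator B (Z \<omega>) *\<^sub>R axis i 1) \<partial>M)"
      unfolding set_lebesgue_integral_def
      by (intro Bochner_Integration.integral_cong)
        (auto simp: A inner_axis algebra_simps split: split_indicator)
    also have "\<dots> = 0"
      using inner_cell_mean_orthogonal(2)[OF I Z Y, of "\<lambda>k. indicator B k *\<^sub>R axis i 1"] .
    finally show "(\<integral>\<omega>\<in>A. Y \<omega> $ i \<partial>M) = (\<integral>\<omega>\<in>A. cell_mean M Z Y (Z \<omega>) $ i \<partial>M)" by simp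
  qed
qed

text \<open>The trace sees only the diagonal, that is, the conditional variances of the components.
  Conditional expectation preserves integrals, so taking expectations leaves the sum of the
  componentwise squared residuals, which is the squared Euclidean norm.\<close>

lemma mse_cell_mean_eq_trace_cond_cov:
  fixes Y :: "'a \<Rightarrow> real ^ 'j"
  assumes I: "finite I" and Z: "Z \<in> measurable M (count_space I)" and Y: "integrable M Y"
    and sq: "integrable M (\<lambda>\<omega>. (norm (Y \<omega>))\<^sup>2)"
  defines "V \<equiv> cond_cov M (vimage_algebra (space M) Z (count_space I)) Y"
  shows "integrable M (\<lambda>\<omega>. trace (V \<omega>))"
    and "mse M Y (\<lambda>\<omega>. cell_mean M Z Y (Z \<omega>)) = ennreal (\<integral>\<omega>. trace (V \<omega>) \<partial>M)"
proof -
  let ?F = "vimage_algebra (space M) Z (count_space I)"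
  let ?m = "cell_mean M Z Y"
  interpret finite_measure_subalgebra M ?F
    by unfold_locales (use measurable_sets[OF Z] measurable_space[OF Z] in
      \<open>auto simp: subalgebra_def sets_vimage_algebra2\<close>)
  note [measurable] = borel_measurable_integrable[OF Y]
  have [measurable]: "(\<lambda>\<omega>. ?m (Z \<omega>)) \<in> borel_measurable M"
    using Z by (rule measurable_compose) simp
  have "mse M Y (\<lambda>\<omega>. 0) < \<infinity>"
    unfolding mse_def using sq by (simp add: nn_integral_eq_integral)
  \<comment> \<open>Comparison with the zero predictor: in the decomposition for
    \<open>u = 0\<close> the approximation term is one summand of a finite total.\<close>
  then have fin: "mse M Y (\<lambda>\<omega>. ?m (Z \<omega>)) < \<infinity>"
    using mse_cell_mean_decomposition[OF I Z Y, of "\<lambda>_. 0"] by simp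
  then have int: "integrable M (\<lambda>\<omega>. (norm (Y \<omega> - ?m (Z \<omega>)))\<^sup>2)"
    by (simp add: mse_def integrable_iff_bounded)
  \<comment> \<open>\<open>e i\<close> is the centring that occurs inside \<open>cond_cov\<close>.
    It agrees with the cell mean only almost everywhere, so the two are exchanged only under
    integrals.\<close>
  define e where "e i \<omega> = real_cond_exp M ?F (\<lambda>\<zeta>. Y \<zeta> $ i) \<omega>" for i \<omega>
  have e_meas [measurable]: "e i \<in> borel_measurable M" for i
    unfolding e_def by simp
  have sq_le: "(x $ i - y $ i)\<^sup>2 \<le> (norm (x - y))\<^sup>2" for x y :: "real ^ 'j" and i
    using component_le_norm_cart[of "x - y" i] by (simp add: abs_le_square_iff[symmetric])
  have [measurable]: "(\<lambda>\<omega>. Y \<omega> $ i) \<in> borel_measurable M" for i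
    by (rule borel_measurable_integrable[OF integrable_bounded_linear[OF bounded_linear_vec_nth Y]])
  have [measurable]: "(\<lambda>\<omega>. ?m (Z \<omega>) $ i) \<in> borel_measurable M" for i
    using Z by (rule measurable_compose) simp
  have int_i: "integrable M (\<lambda>\<omega>. (Y \<omega> $ i - ?m (Z \<omega>) $ i)\<^sup>2)" for i
    by (rule Bochner_Integration.integrable_bound[OF int])
      (auto simp: sq_le)
  have AE_e: "AE \<omega> in M. (Y \<omega> $ i - e i \<omega>) * (Y \<omega> $ i - e i \<omega>) = (Y \<omega> $ i - ?m (Z \<omega>) $ i)\<^sup>2" for i
    using real_cond_exp_eq_cell_mean[OF I Z Y, of i] by eventually_elim (simp add: e_def power2_eq_square)
  have int_e: "integrable M (\<lambda>\<omega>. (Y \<omega> $ i - e i \<omega>) * (Y \<omega> $ i - e i \<omega>))" for i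
    by (subst integrable_cong_AE[OF _ _ AE_e]) (auto intro: int_i)
  have trV: "trace (V \<omega>) = (\<Sum>i\<in>UNIV. real_cond_exp M ?F (\<lambda>\<xi>. (Y \<xi> $ i - e i \<xi>) * (Y \<xi> $ i - e i \<xi>)) \<omega>)" for \<omega>
    by (simp add: trace_def V_def cond_cov_def e_def)
  show "integrable M (\<lambda>\<omega>. trace (V \<omega>))"
    unfolding trV by (intro Bochner_Integration.integrable_sum real_cond_exp_int(1) int_e)
  have "(\<integral>\<omega>. trace (V \<omega>) \<partial>M) = (\<Sum>i\<in>UNIV. \<integral>\<omega>. (Y \<omega> $ i - e i \<omega>) * (Y \<omega> $ i - e i \<omega>) \<partial>M)"
    unfolding trV
    by (subst Bochner_Integration.integral_sum) (simp_all add: real_cond_exp_int int_e)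
  also have "\<dots> = (\<Sum>i\<in>UNIV. \<integral>\<omega>. (Y \<omega> $ i - ?m (Z \<omega>) $ i)\<^sup>2 \<partial>M)"
    by (intro sum.cong refl integral_cong_AE AE_e) auto
  also have "\<dots> = (\<integral>\<omega>. (norm (Y \<omega> - ?m (Z \<omega>)))\<^sup>2 \<partial>M)"
    by (subst Bochner_Integration.integral_sum[symmetric])
      (auto simp: int_i norm_vec_def L2_set_def sum_nonneg)
  finally show "mse M Y (\<lambda>\<omega>. ?m (Z \<omega>)) = ennreal (\<integral>\<omega>. trace (V \<omega>) \<partial>M)"
    using int by (simp add: mse_def nn_integral_eq_integral)
qed

section \<open>Estimators trained on independent data\<close>

lemma nn_integral_indep:
  assumes D [measurable]: "D \<in> measurable M S" and X [measurable]: "X \<in> measurable M N"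
    and ind: "indep_set (sets (vimage_algebra (space M) X N)) (sets (vimage_algebra (space M) D S))"
    and h [measurable]: "case_prod h \<in> borel_measurable (S \<Otimes>\<^sub>M N)"
  shows "(\<integral>\<^sup>+\<omega>. h (D \<omega>) (X \<omega>) \<partial>M) = (\<integral>\<^sup>+d. \<integral>\<^sup>+\<omega>. h d (X \<omega>) \<partial>M \<partial>distr M S D)"
    and "(\<lambda>d. \<integral>\<^sup>+\<omega>. h d (X \<omega>) \<partial>M) \<in> borel_measurable (distr M S D)"
proof -
  interpret Q: prob_space "distr M S D" by (rule prob_space_distr) fact
  interpret P: prob_space "distr M N X" by (rule prob_space_distr) fact
  \<comment> \<open>Independence makes the joint law of data and context the product of their laws.
    It suffices to compare the two on rectangles, where this is the product rule for preimages;
    Tonelli then applies.\<close>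
  have pair: "distr M S D \<Otimes>\<^sub>M distr M N X = distr M (S \<Otimes>\<^sub>M N) (\<lambda>\<omega>. (D \<omega>, X \<omega>))"
  proof (rule pair_measure_eqI)
    fix A B assume "A \<in> sets (distr M S D)" "B \<in> sets (distr M N X)"
    then have [measurable]: "A \<in> sets S" "B \<in> sets N" by auto
    have "prob ((X -` B \<inter> space M) \<inter> (D -` A \<inter> space M)) =
        prob (X -` B \<inter> space M) * prob (D -` A \<inter> space M)"
      by (rule indep_setD[OF ind]) (auto intro!: in_vimage_algebra)
    moreover have "(\<lambda>\<omega>. (D \<omega>, X \<omega>)) -` (A \<times> B) \<inter> space M = (X -` B \<inter> space M) \<inter> (D -` A \<inter> space M)"
      by auto
    ultimately show "emeasure (distr M S D) A * emeasure (distr M N X) B =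
        emeasure (distr M (S \<Otimes>\<^sub>M N) (\<lambda>\<omega>. (D \<omega>, X \<omega>))) (A \<times> B)"
      by (simp add: emeasure_distr emeasure_eq_measure ennreal_mult mult.commute)
  qed (auto intro: Q.sigma_finite_measure_axioms P.sigma_finite_measure_axioms cong: sets_pair_measure_cong)
  have inner: "(\<integral>\<^sup>+\<omega>. h d (X \<omega>) \<partial>M) = (\<integral>\<^sup>+x. h d x \<partial>distr M N X)" if "d \<in> space S" for d
    using measurable_Pair2[OF h that] by (simp add: nn_integral_distr)
  have "(\<integral>\<^sup>+\<omega>. h (D \<omega>) (X \<omega>) \<partial>M) = (\<integral>\<^sup>+z. case_prod h z \<partial>(distr M S D \<Otimes>\<^sub>M distr M N X))"
    unfolding pair by (subst nn_integral_distr) auto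
  also have "\<dots> = (\<integral>\<^sup>+d. \<integral>\<^sup>+x. h d x \<partial>distr M N X \<partial>distr M S D)"
    by (subst P.nn_integral_fst[symmetric]) auto
  also have "\<dots> = (\<integral>\<^sup>+d. \<integral>\<^sup>+\<omega>. h d (X \<omega>) \<partial>M \<partial>distr M S D)"
    by (intro nn_integral_cong) (simp add: inner)
  finally show "(\<integral>\<^sup>+\<omega>. h (D \<omega>) (X \<omega>) \<partial>M) = (\<integral>\<^sup>+d. \<integral>\<^sup>+\<omega>. h d (X \<omega>) \<partial>M \<partial>distr M S D)" .
  \<comment> \<open>This measurability in \<open>d\<close> is what later permits splitting the
    integral of a sum over the data.\<close>
  have "(\<lambda>d. \<integral>\<^sup>+x. h d x \<partial>distr M N X) \<in> borel_measurable (distr M S D)"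
    by measurable
  then show "(\<lambda>d. \<integral>\<^sup>+\<omega>. h d (X \<omega>) \<partial>M) \<in> borel_measurable (distr M S D)"
    by (subst measurable_cong[OF inner]) auto
qed

end

text \<open>Measurability in the data at each fixed context gives joint measurability because
  \<open>A d\<close> depends on the context only through its cell: \<open>A\<close> is a finite sum
  of cell indicators times the values at one representative per cell.\<close>

lemma hard_estimator_jointly_measurable:
  fixes A :: "'d \<Rightarrow> 'x \<Rightarrow> real ^ 'j"
  assumes I: "finite I" and C: "C \<in> measurable N (count_space I)"
    and hard: "\<And>d. d \<in> space S \<Longrightarrow> A d \<in> hard_class N C"
    and A [measurable]: "\<And>x. x \<in> space N \<Longrightarrow> (\<lambda>d. A d x) \<in> borel_measurable S"
  shows "case_prod A \<in> borel_measurable (S \<Otimes>\<^sub>M N)"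
proof -
  define r where "r k = (SOME x. x \<in> space N \<and> C x = k)" for k
  have r: "r (C x) \<in> space N" "C (r (C x)) = C x" if "x \<in> space N" for x
    using someI[of "\<lambda>y. y \<in> space N \<and> C y = C x" x] that by (auto simp: r_def)
  have Ar: "A d x = A d (r (C x))" if "d \<in> space S" "x \<in> space N" for d x
    using hard[OF that(1)] that r[OF that(2)] unfolding hard_class_def by force
  \<comment> \<open>Only nonempty cells are kept: for these \<open>r k\<close> lies in
    \<open>space N\<close>, where measurability in \<open>d\<close> is assumed.\<close>
  define J where "J = C ` space N"
  have J: "finite J" "J \<subseteq> I"
    using I measurable_space[OF C] by (auto simp: J_def intro: finite_subset)
  have cell: "{x \<in> space N. C x = k} \<in> sets N" if "k \<in> J" for k
    using measurable_sets[OF C, of "{k}"] that J by (auto simp: vimage_def Int_def conj_commute)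
  have meas: "(\<lambda>(d, x). indicator {x \<in> space N. C x = k} x *\<^sub>R A d (r k)) \<in> borel_measurable (S \<Otimes>\<^sub>M N)"
    if "k \<in> J" for k
  proof -
    have [measurable]: "(\<lambda>d. A d (r k)) \<in> borel_measurable S"
      using that r by (auto simp: J_def)
    note [measurable] = cell[OF that]
    show ?thesis by measurable
  qed
  have "(\<Sum>k\<in>J. indicator {x \<in> space N. C x = k} x *\<^sub>R A d (r k)) = A d x"
    if "d \<in> space S" "x \<in> space N" for d x
  proof -
    have "(\<Sum>k\<in>J. indicator {x \<in> space N. C x = k} x *\<^sub>R A d (r k)) =
        (\<Sum>k\<in>J. if k = C x then A d (r k) else 0)"
      using that by (intro sum.cong) auto
    then show ?thesis using that J Ar by (simp add: J_def)
  qed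
  then have "case_prod A z = (\<Sum>k\<in>J. (\<lambda>(d, x). indicator {x \<in> space N. C x = k} x *\<^sub>R A d (r k)) z)"
    if "z \<in> space (S \<Otimes>\<^sub>M N)" for z
    using that by (auto simp: space_pair_measure)
  then show ?thesis
    by (subst measurable_cong) (auto intro!: borel_measurable_sum meas)
qed

text \<open>The first two conjuncts are identities in the extended nonnegative reals, for a fixed
  member of the class and for an estimator trained on independent data. The third has square
  integrability as a premise because its right side, the \<open>ennreal\<close> of a real number, is
  always finite.\<close>

theorem proposition1:
  fixes M :: "'m measure" and N :: "'x measure" and X :: "'m \<Rightarrow> 'x"
    and w :: "'x \<Rightarrow> real ^ 'j" and C :: "'x \<Rightarrow> nat" and K :: nat
  assumes "prob_space M"
    and "X \<in> measurable M N"
    and "w \<in> borel_measurable N"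
    and "C \<in> measurable N (count_space {1..K})"
    and "integrable M (\<lambda>\<omega>. w (X \<omega>))"
  shows
    "(\<forall>v \<in> hard_class N C.
        mse M (\<lambda>\<omega>. w (X \<omega>)) (\<lambda>\<omega>. v (X \<omega>)) =
        approx_error M X C w + mse M (\<lambda>\<omega>. cond_mean_proj M X C w (X \<omega>)) (\<lambda>\<omega>. v (X \<omega>))) \<and>
     (\<forall>(S :: 'd measure) D A. hard_estimator M N X C S D A \<longrightarrow>
        mse M (\<lambda>\<omega>. w (X \<omega>)) (\<lambda>\<omega>. A (D \<omega>) (X \<omega>)) =
        approx_error M X C w +
        mse M (\<lambda>\<omega>. cond_mean_proj M X C w (X \<omega>)) (\<lambda>\<omega>. A (D \<omega>) (X \<omega>))) \<and>
     (integrable M (\<lambda>\<omega>. (norm (w (X \<omega>)))\<^sup>2) \<longrightarrow>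
        (let V = cond_cov M (vimage_algebra (space M) (\<lambda>\<omega>. C (X \<omega>)) (count_space {1..K}))
                   (\<lambda>\<omega>. w (X \<omega>))
         in integrable M (\<lambda>\<omega>. trace (V \<omega>)) \<and>
            approx_error M X C w = ennreal (\<integral>\<omega>. trace (V \<omega>) \<partial>M)))"
proof -
  interpret prob_space M by fact
  let ?Z = "\<lambda>\<omega>. C (X \<omega>)" and ?Y = "\<lambda>\<omega>. w (X \<omega>)"
  let ?m = "cond_mean_proj M X C w"
  note [measurable] = assms(2-4)
  have Z: "?Z \<in> measurable M (count_space {1..K})" by measurable
  \<comment> \<open>The projection is the cell mean for the labelling that \<open>C\<close> and
    \<open>X\<close> induce on the sample space, which brings the lemmas above into play.\<close>
  have m: "?m x = cell_mean M ?Z ?Y (C x)" for x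
    by (simp add: cond_mean_proj_def cell_mean_def)
  have 1: "mse M ?Y (\<lambda>\<omega>. v (X \<omega>)) = approx_error M X C w + mse M (\<lambda>\<omega>. ?m (X \<omega>)) (\<lambda>\<omega>. v (X \<omega>))"
    if "v \<in> hard_class N C" for v
  proof -
    obtain \<beta> where "\<And>x. x \<in> space N \<Longrightarrow> v x = \<beta> (C x)"
      using \<open>v \<in> hard_class N C\<close> by (auto simp: hard_class_def)
    \<comment> \<open>\<open>v\<close> is known to factor through \<open>C\<close> only on
      \<open>space N\<close>; this suffices, since \<open>X\<close> takes its values there.\<close>
    then have "mse M f (\<lambda>\<omega>. v (X \<omega>)) = mse M f (\<lambda>\<omega>. \<beta> (?Z \<omega>))" for f
      unfolding mse_def by (intro nn_integral_cong) (simp add: measurable_space[OF assms(2)])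
    then show ?thesis
      using mse_cell_mean_decomposition[OF _ Z assms(5), of \<beta>] by (simp add: approx_error_def m)
  qed
  have 2: "mse M ?Y (\<lambda>\<omega>. A (D \<omega>) (X \<omega>)) =
      approx_error M X C w + mse M (\<lambda>\<omega>. ?m (X \<omega>)) (\<lambda>\<omega>. A (D \<omega>) (X \<omega>))"
    if "hard_estimator M N X C S D A" for S :: "'d measure" and D A
  proof -
    from that have D [measurable]: "D \<in> measurable M S"
      and ind: "indep_set (sets (vimage_algebra (space M) X N)) (sets (vimage_algebra (space M) D S))"
      and hard: "\<And>d. d \<in> space S \<Longrightarrow> A d \<in> hard_class N C"
      and A: "\<And>x. x \<in> space N \<Longrightarrow> (\<lambda>d. A d x) \<in> borel_measurable S"
      by (auto simp: hard_estimator_def)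
    have [measurable]: "case_prod A \<in> borel_measurable (S \<Otimes>\<^sub>M N)"
      by (rule hard_estimator_jointly_measurable[OF _ assms(4) hard A]) simp_all
    have m_meas [measurable]: "?m \<in> borel_measurable N"
      unfolding m using assms(4) by (rule measurable_compose) simp
    interpret Q: prob_space "distr M S D" by (rule prob_space_distr) fact
    have fubini: "mse M (\<lambda>\<omega>. f (X \<omega>)) (\<lambda>\<omega>. A (D \<omega>) (X \<omega>)) =
          (\<integral>\<^sup>+d. mse M (\<lambda>\<omega>. f (X \<omega>)) (\<lambda>\<omega>. A d (X \<omega>)) \<partial>distr M S D)"
        "(\<lambda>d. mse M (\<lambda>\<omega>. f (X \<omega>)) (\<lambda>\<omega>. A d (X \<omega>))) \<in> borel_measurable (distr M S D)"
      if [measurable]: "f \<in> borel_measurable N" for f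
      unfolding mse_def
      by (rule nn_integral_indep[OF D assms(2) ind, of "\<lambda>d x. ennreal ((norm (f x - A d x))\<^sup>2)"]; measurable)+
    \<comment> \<open>Freeze the data at \<open>d\<close>, apply the identity for the fixed function
      \<open>A d\<close>, and average over the law of \<open>D\<close>. The approximation error does
      not depend on \<open>d\<close>, and that law has total mass one, so it integrates to
      itself.\<close>
    have "mse M ?Y (\<lambda>\<omega>. A (D \<omega>) (X \<omega>)) =
        (\<integral>\<^sup>+d. approx_error M X C w + mse M (\<lambda>\<omega>. ?m (X \<omega>)) (\<lambda>\<omega>. A d (X \<omega>)) \<partial>distr M S D)"
      unfolding fubini(1)[OF assms(3)] by (intro nn_integral_cong 1 hard) simp
    also have "\<dots> = approx_error M X C w + mse M (\<lambda>\<omega>. ?m (X \<omega>)) (\<lambda>\<omega>. A (D \<omega>) (X \<omega>))"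
      unfolding fubini(1)[OF m_meas]
      by (subst nn_integral_add) (use fubini(2)[OF m_meas] in \<open>auto simp: Q.emeasure_space_1[simplified]\<close>)
    finally show ?thesis .
  qed
  have 3: "let V = cond_cov M (vimage_algebra (space M) ?Z (count_space {1..K})) ?Y
      in integrable M (\<lambda>\<omega>. trace (V \<omega>)) \<and> approx_error M X C w = ennreal (\<integral>\<omega>. trace (V \<omega>) \<partial>M)"
    if "integrable M (\<lambda>\<omega>. (norm (w (X \<omega>)))\<^sup>2)"
    using mse_cell_mean_eq_trace_cond_cov[OF _ Z assms(5) that]
    by (simp add: Let_def approx_error_def m)
  show ?thesis using 1 2 3 by blast
qed

end
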